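(* For integers $n\ge0$ and $p\ge1$, \[ \sum_{m_p\geq \dots\geq m_{1}\geq 0} \frac{q^{m_p^2+m_{p-1}^2 +\dots+m_1^2}(q;q^2)_{m_1}(q;q)_{2n}}{(q;q)_{n-m_p}(q;q)_{m_p - m_{p-1}}\cdots (q;q)_{m_2-m_1}(q;q)_{2m_1}}= \sum_{r=-\infty}^{\infty} (-1)^r q^{(p+1)r^2} {2n\brack n -r }_q. \]
   Context: $(a;q)_m=\prod_{j=0}^{m-1}(1-aq^j)$ for $m\ge0$ and $1/(q;q)_m:=0$ for $m<0$; $(q;q^2)_m=\prod_{j=0}^{m-1}(1-q^{2j+1})$. The sum is over integers $m_p\ge\dots\ge m_1\ge0$ (for $p=1$ the denominator is $(q;q)_{n-m_1}(q;q)_{2m_1}$). For integers $a,b$, ${a\brack b}_q=\frac{(q;q)_a}{(q;q)_b(q;q)_{a-b}}$ if $0\le b\le a$ and $0$ otherwise. *)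

theory Defs
  imports Main "HOL-Library.FuncSet" "HOL-Library.Groups_Big_Fun"
begin

definition qpoch :: "'a::field \<Rightarrow> 'a \<Rightarrow> nat \<Rightarrow> 'a" where
  "qpoch a q m = (\<Prod>j<m. 1 - a * q ^ j)"

text \<open>The reciprocal \<open>1/(q;q)\<^sub>m\<close> for integer \<open>m\<close>, with the convention that it
  vanishes for \<open>m < 0\<close>.\<close>

definition inv_qpoch :: "'a::field \<Rightarrow> int \<Rightarrow> 'a" where
  "inv_qpoch q m = (if m < 0 then 0 else 1 / qpoch q q (nat m))"

definition qbinom :: "'a::field \<Rightarrow> int \<Rightarrow> int \<Rightarrow> 'a" where
  "qbinom q a b =
     (if 0 \<le> b \<and> b \<le> a
      then qpoch q q (nat a) / (qpoch q q (nat b) * qpoch q q (nat (a - b)))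
      else 0)"

text \<open>Tuples \<open>m\<^sub>p \<ge> \<dots> \<ge> m\<^sub>1 \<ge> 0\<close> of integers, as extensional functions on \<open>{1..p}\<close>, so that
  each tuple is represented exactly once.\<close>

definition mtuples :: "nat \<Rightarrow> (nat \<Rightarrow> int) set" where
  "mtuples p = {m \<in> {1..p} \<rightarrow>\<^sub>E {0..}. \<forall>i\<in>{1..<p}. m i \<le> m (Suc i)}"

text \<open>Sums over all tuples and over all integers \<open>r\<close> are written with \<open>Sum_any\<close>, which is only
  meaningful for finite support; the factors below guarantee this.\<close>

lemma mtuples_le_last:
  assumes "m \<in> mtuples p" and "i \<in> {1..p}"
  shows "m i \<le> m p"
proof -
  have "i \<le> p" using assms(2) by simp
  then show ?thesis
  proof (induction rule: inc_induct)
    case (step k)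
    then have "k \<in> {1..<p}" using assms(2) by auto
    then have "m k \<le> m (Suc k)" using assms(1) by (auto simp: mtuples_def)
    with step.IH show ?case by linarith
  qed simp
qed

lemma finite_support_tuples: "finite {m \<in> mtuples p. inv_qpoch q (int n - m p) \<noteq> 0}"
proof (rule finite_subset)
  show "{m \<in> mtuples p. inv_qpoch q (int n - m p) \<noteq> 0} \<subseteq> {1..p} \<rightarrow>\<^sub>E {0..int n}"
  proof
    fix m assume "m \<in> {m \<in> mtuples p. inv_qpoch q (int n - m p) \<noteq> 0}"
    then have c: "m \<in> mtuples p" and mp: "m p \<le> int n"
      by (auto simp: inv_qpoch_def split: if_splits)
    have "m i \<in> {0..int n}" if "i \<in> {1..p}" for i
      using mtuples_le_last[OF c that] mp c that by (force simp: mtuples_def PiE_iff)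
    then show "m \<in> {1..p} \<rightarrow>\<^sub>E {0..int n}"
      using c by (auto simp: mtuples_def PiE_iff)
  qed
  show "finite ({1..p} \<rightarrow>\<^sub>E {0..int n})" by (intro finite_PiE) auto
qed

lemma finite_support_qbinom: "finite {r. qbinom q (2 * int n) (int n - r) \<noteq> 0}"
  by (rule finite_subset[of _ "{- int n..int n}"]) (auto simp: qbinom_def split: if_splits)

end

theory Submission imports Defs begin

text \<open>
  The right-hand side divided by \<open>(q;q)\<^sub>2\<^sub>n\<close> is
  \<open>\<Sum>\<^sub>r \<alpha>\<^sub>r / ((q;q)\<^sub>n\<^sub>-\<^sub>r (q;q)\<^sub>n\<^sub>+\<^sub>r)\<close> with \<open>\<alpha>\<^sub>r = (-1)\<^sup>r q^((p+1)r\<^sup>2)\<close>, that is, a member of a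
  Bailey pair relative to \<open>1\<close>. Multiplying \<open>\<alpha>\<^sub>r\<close> by \<open>q^(r\<^sup>2)\<close> amounts to replacing \<open>\<beta>\<^sub>n\<close> by
  \<open>\<Sum>\<^sub>m q^(m\<^sup>2) \<beta>\<^sub>m / (q;q)\<^sub>n\<^sub>-\<^sub>m\<close> (a limiting q-Vandermonde sum), and iterating this \<open>p\<close> times
  produces the multiple sum. The starting pair, \<open>\<alpha>\<^sub>r = (-1)\<^sup>r q^(r\<^sup>2)\<close> and
  \<open>\<beta>\<^sub>n = (q;q\<^sup>2)\<^sub>n / (q;q)\<^sub>2\<^sub>n\<close>, is obtained from a first-order recurrence in \<open>n\<close> by telescoping.
  No step divides by \<open>q\<close>, so that \<open>q = 0\<close> is covered.
\<close>

section \<open>Reciprocal q-factorials\<close>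

text \<open>Nonnegative exponents keep the addition law valid at \<open>q = 0\<close>, where
  negative powers are 0.\<close>

lemma powi_add_nonneg:
  fixes q :: "'a::field"
  assumes "a \<ge> 0" "b \<ge> 0"
  shows "q powi (a + b) = q powi a * q powi b"
  using assms by (simp add: power_int_def nat_add_distrib power_add)

lemma qpoch_Suc: "qpoch a q (Suc m) = qpoch a q m * (1 - a * q ^ m)"
  by (simp add: qpoch_def)

lemma inv_qpoch_neg [simp]: "m < 0 \<Longrightarrow> inv_qpoch q m = 0"
  by (simp add: inv_qpoch_def)

lemma inv_qpoch_0 [simp]: "inv_qpoch q 0 = 1"
  by (simp add: inv_qpoch_def qpoch_def)

text \<open>Valid for every integer \<open>m\<close>: at \<open>m = 0\<close> the factor
  \<open>1 - q powi 0\<close> vanishes, and for \<open>m < 0\<close> both reciprocals are 0 by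
  convention.\<close>

lemma inv_qpoch_diff_one:
  fixes q :: "'a::field"
  assumes q: "\<forall>k::nat\<ge>1. q ^ k \<noteq> 1"
  shows "inv_qpoch q (m - 1) = inv_qpoch q m * (1 - q powi m)"
proof (cases "m \<ge> 1")
  case True
  then obtain k where m: "m = int (Suc k)"
    using that[of "nat (m - 1)"] by simp
  have "1 - q * q ^ k \<noteq> 0" using q[rule_format, of "Suc k"] by simp
  then show ?thesis
    by (simp add: m inv_qpoch_def qpoch_Suc power_int_def nat_add_distrib)
next
  case False
  then show ?thesis by (cases "m = 0") simp_all
qed

lemma inv_qpoch_Suc:
  fixes q :: "'a::field"
  assumes q: "\<forall>k::nat\<ge>1. q ^ k \<noteq> 1"
  shows "inv_qpoch q (int k) = inv_qpoch q (int (Suc k)) * (1 - q ^ Suc k)"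
  using inv_qpoch_diff_one[OF q, of "int (Suc k)"] by (simp add: power_int_def nat_add_distrib)

section \<open>Limiting q-Vandermonde sum and Bailey kernel\<close>

text \<open>Induction on \<open>N\<close> with \<open>a\<close> free. Multiplying by
  \<open>1 - q ^ Suc N\<close> splits each term in two: one part lowers \<open>N - j\<close> and
  gives the sum for \<open>N\<close>, \<open>a\<close>; the other lowers \<open>j\<close> and gives
  the sum for \<open>N\<close>, \<open>Suc a\<close>.\<close>

lemma q_vandermonde_limit:
  fixes q :: "'a::field"
  assumes q: "\<forall>k::nat\<ge>1. q ^ k \<noteq> 1"
  shows "(\<Sum>j\<le>N. q ^ (j^2 + a * j) * inv_qpoch q (int (N - j)) * inv_qpoch q (int j)
            * inv_qpoch q (int (j + a)))
       = inv_qpoch q (int N) * inv_qpoch q (int (N + a))"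
proof (induction N arbitrary: a)
  case 0
  show ?case by simp
next
  case (Suc N)
  let ?P = "\<lambda>k. inv_qpoch q (int k)"
  let ?t = "\<lambda>j. q ^ (j^2 + a * j) * ?P (Suc N - j) * ?P j * ?P (j + a)"
  note rec = inv_qpoch_Suc[OF q]
  have split: "(1 - q ^ Suc N) * ?t j = (1 - q ^ (Suc N - j)) * ?t j + q ^ (Suc N - j) * (1 - q ^ j) * ?t j"
    if "j \<le> Suc N" for j
  proof -
    have "q ^ Suc N = q ^ (Suc N - j) * q ^ j"
      using that by (metis le_add_diff_inverse2 power_add)
    then show ?thesis by (simp add: algebra_simps)
  qed
  have "(1 - q ^ Suc N) * (\<Sum>j\<le>Suc N. ?t j)
      = (\<Sum>j\<le>Suc N. (1 - q ^ (Suc N - j)) * ?t j)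
        + (\<Sum>j\<le>Suc N. q ^ (Suc N - j) * (1 - q ^ j) * ?t j)"
    unfolding sum_distrib_left sum.distrib[symmetric]
    by (intro sum.cong refl split) simp
  also have "(\<Sum>j\<le>Suc N. (1 - q ^ (Suc N - j)) * ?t j)
      = (\<Sum>j\<le>N. q ^ (j^2 + a * j) * ?P (N - j) * ?P j * ?P (j + a))"
  proof -
    have "(1 - q ^ (Suc N - j)) * ?t j = q ^ (j^2 + a * j) * ?P (N - j) * ?P j * ?P (j + a)"
      if "j \<le> N" for j
      using that by (simp only: Suc_diff_le rec[of "N - j"] mult_ac)
    then have "(\<Sum>j\<le>N. (1 - q ^ (Suc N - j)) * ?t j)
        = (\<Sum>j\<le>N. q ^ (j^2 + a * j) * ?P (N - j) * ?P j * ?P (j + a))"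
      by (intro sum.cong refl) simp_all
    then show ?thesis by (simp only: sum.atMost_Suc) simp
  qed
  also have "\<dots> = ?P N * ?P (N + a)"
    by (rule Suc.IH)
  \<comment> \<open>The term \<open>j = 0\<close> vanishes, so \<open>j\<close> is shifted by one;
    the factor \<open>q ^ (Suc N + a)\<close> comes from completing the exponents.\<close>
  also have "(\<Sum>j\<le>Suc N. q ^ (Suc N - j) * (1 - q ^ j) * ?t j)
      = (\<Sum>j\<le>N. q ^ (Suc N + a)
          * (q ^ (j^2 + Suc a * j) * ?P (N - j) * ?P j * ?P (j + Suc a)))"
  proof -
    have "q ^ (Suc N - Suc j) * (1 - q ^ Suc j) * ?t (Suc j)
        = q ^ (Suc N + a) * (q ^ (j^2 + Suc a * j) * ?P (N - j) * ?P j * ?P (j + Suc a))"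
      if "j \<le> N" for j
    proof -
      have "(N - j) + ((Suc j)^2 + a * Suc j) = Suc N + a + (j^2 + Suc a * j)"
        using that by (simp add: power2_eq_square)
      then have "q ^ (N - j) * q ^ ((Suc j)^2 + a * Suc j)
          = q ^ (Suc N + a) * q ^ (j^2 + Suc a * j)"
        by (simp only: power_add[symmetric])
      then have "(q ^ (N - j) * q ^ ((Suc j)^2 + a * Suc j)) * (?P (N - j) * ((1 - q ^ Suc j) * ?P (Suc j))
            * ?P (Suc j + a))
          = (q ^ (Suc N + a) * q ^ (j^2 + Suc a * j)) * (?P (N - j) * ((1 - q ^ Suc j) * ?P (Suc j))
            * ?P (Suc j + a))"
        by (rule arg_cong)
      then show ?thesis
        unfolding diff_Suc_Suc add_Suc_shift[symmetric] rec[of j] by (simp only: mult_ac)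
    qed
    then have "(\<Sum>j\<le>N. q ^ (Suc N - Suc j) * (1 - q ^ Suc j) * ?t (Suc j))
        = (\<Sum>j\<le>N. q ^ (Suc N + a)
          * (q ^ (j^2 + Suc a * j) * ?P (N - j) * ?P j * ?P (j + Suc a)))"
      by (intro sum.cong refl) (simp only: atMost_iff)
    then show ?thesis by (simp only: sum.atMost_Suc_shift) simp
  qed
  also have "\<dots> = q ^ (Suc N + a) * (?P N * ?P (N + Suc a))"
    unfolding sum_distrib_left[symmetric] Suc.IH ..
  also have "?P N * ?P (N + a) + q ^ (Suc N + a) * (?P N * ?P (N + Suc a))
      = (1 - q ^ Suc N) * (?P (Suc N) * ?P (Suc N + a))"
    \<comment> \<open>both sides equal \<open>?P N * ?P (Suc (N + a))\<close>\<close>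
    unfolding rec[of "N + a"] rec[of N] add_Suc add_Suc_right by (simp only: algebra_simps) simp
  finally show ?case
    using q[rule_format, of "Suc N"] by simp
qed

text \<open>Only \<open>m \<ge> r\<close> contributes. Substituting \<open>m = j + r\<close> splits
  the square as \<open>r^2 + (j^2 + 2 * r * j)\<close>, which is the Vandermonde sum with
  \<open>a = 2 * r\<close>.\<close>

lemma bailey_kernel_nat:
  fixes q :: "'a::field"
  assumes q: "\<forall>k::nat\<ge>1. q ^ k \<noteq> 1" and "r \<le> n"
  shows "(\<Sum>m\<le>n. q ^ (m^2) * inv_qpoch q (int n - int m) * inv_qpoch q (int m - int r)
            * inv_qpoch q (int m + int r))
       = q ^ (r^2) * inv_qpoch q (int n - int r) * inv_qpoch q (int n + int r)"
proof -
  let ?f = "\<lambda>m. q ^ (m^2) * inv_qpoch q (int n - int m) * inv_qpoch q (int m - int r)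
            * inv_qpoch q (int m + int r)"
  have "(\<Sum>m\<le>n. ?f m) = (\<Sum>m\<in>{r..n}. ?f m)"
    by (rule sum.mono_neutral_right) auto
  also have "\<dots> = (\<Sum>j\<le>n - r. ?f (j + r))"
    by (rule sum.reindex_bij_witness[of _ "\<lambda>j. j + r" "\<lambda>m. m - r"]) (use assms(2) in auto)
  also have "\<dots> = q ^ (r^2) * (\<Sum>j\<le>n - r. q ^ (j^2 + (2 * r) * j) * inv_qpoch q (int (n - r - j))
        * inv_qpoch q (int j) * inv_qpoch q (int (j + 2 * r)))"
    unfolding sum_distrib_left
  proof (rule sum.cong[OF refl])
    fix j assume "j \<in> {..n - r}"
    then have "int n - int (j + r) = int (n - r - j)" "int (j + r) - int r = int j"
      "int (j + r) + int r = int (j + 2 * r)"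
      using assms(2) by auto
    moreover have "q ^ ((j + r)^2) = q ^ (r^2) * q ^ (j^2 + (2 * r) * j)"
      unfolding power_add[symmetric] by (rule arg_cong[where f = "(^) q"]) (simp add: power2_eq_square algebra_simps)
    ultimately show "?f (j + r) = q ^ (r^2) * (q ^ (j^2 + (2 * r) * j) * inv_qpoch q (int (n - r - j))
        * inv_qpoch q (int j) * inv_qpoch q (int (j + 2 * r)))"
      by (simp only: mult.assoc)
  qed
  also have "\<dots> = q ^ (r^2) * inv_qpoch q (int n - int r) * inv_qpoch q (int n + int r)"
  proof -
    have "int (n - r) = int n - int r" "int (n - r + 2 * r) = int n + int r"
      using assms(2) by auto
    then show ?thesis
      unfolding q_vandermonde_limit[OF q] by (simp only: mult.assoc)
  qed
  finally show ?thesis .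
qed

text \<open>Both sides are invariant under \<open>r \<mapsto> -r\<close>.\<close>

lemma bailey_kernel:
  fixes q :: "'a::field"
  assumes q: "\<forall>k::nat\<ge>1. q ^ k \<noteq> 1" and r: "r \<in> {- int n..int n}"
  shows "(\<Sum>m\<le>n. q ^ (m^2) * inv_qpoch q (int n - int m) * inv_qpoch q (int m - r)
            * inv_qpoch q (int m + r))
       = q powi (r^2) * inv_qpoch q (int n - r) * inv_qpoch q (int n + r)"
proof (cases "r \<ge> 0")
  case True
  then obtain k where "r = int k" by (metis nonneg_int_cases)
  then show ?thesis
    using bailey_kernel_nat[OF q, of k n] r by (simp add: power_int_def nat_power_eq)
next
  case False
  then obtain k where "r = - int k" by (metis nle_le nonpos_int_cases)
  then show ?thesis
    using bailey_kernel_nat[OF q, of k n] r by (simp add: power_int_def nat_power_eq mult_ac)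
qed

section \<open>The Bailey lemma\<close>

text \<open>The \<open>\<beta>\<close> of a Bailey pair relative to 1, with \<open>\<alpha>\<close>
  indexed by all integers instead of folding \<open>r\<close> and \<open>-r\<close>
  together.\<close>

definition bailey_sum :: "'a::field \<Rightarrow> (int \<Rightarrow> 'a) \<Rightarrow> nat \<Rightarrow> 'a" where
  "bailey_sum q \<alpha> n = (\<Sum>r\<in>{- int n..int n}. \<alpha> r * inv_qpoch q (int n - r) * inv_qpoch q (int n + r))"

lemma bailey_sum_step:
  fixes q :: "'a::field"
  assumes q: "\<forall>k::nat\<ge>1. q ^ k \<noteq> 1"
  shows "(\<Sum>m\<le>n. q ^ (m^2) * inv_qpoch q (int n - int m) * bailey_sum q \<alpha> m)
       = bailey_sum q (\<lambda>r. \<alpha> r * q powi (r^2)) n"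
proof -
  \<comment> \<open>A range of \<open>r\<close> independent of \<open>m\<close> allows the sums to
    be interchanged; the added terms contain the reciprocal at a negative index.\<close>
  have ext: "bailey_sum q \<alpha> m
      = (\<Sum>r\<in>{- int n..int n}. \<alpha> r * inv_qpoch q (int m - r) * inv_qpoch q (int m + r))"
    if "m \<le> n" for m
    unfolding bailey_sum_def
    by (rule sum.mono_neutral_left) (use that in \<open>auto simp: not_le\<close>)
  have "(\<Sum>m\<le>n. q ^ (m^2) * inv_qpoch q (int n - int m) * bailey_sum q \<alpha> m)
      = (\<Sum>m\<le>n. \<Sum>r\<in>{- int n..int n}. \<alpha> r * (q ^ (m^2) * inv_qpoch q (int n - int m)
          * inv_qpoch q (int m - r) * inv_qpoch q (int m + r)))"
    by (intro sum.cong refl) (simp add: ext sum_distrib_left mult_ac)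
  also have "\<dots> = (\<Sum>r\<in>{- int n..int n}. \<alpha> r * (\<Sum>m\<le>n. q ^ (m^2) * inv_qpoch q (int n - int m)
          * inv_qpoch q (int m - r) * inv_qpoch q (int m + r)))"
    by (subst sum.swap) (simp add: sum_distrib_left)
  also have "\<dots> = bailey_sum q (\<lambda>r. \<alpha> r * q powi (r^2)) n"
    unfolding bailey_sum_def
    by (rule sum.cong[OF refl]) (simp only: bailey_kernel[OF q], simp only: mult.assoc)
  finally show ?thesis .
qed

section \<open>The starting Bailey pair\<close>

lemma sum_int_telescope:
  fixes u :: "int \<Rightarrow> 'a::ab_group_add"
  assumes "a \<le> b + 1"
  shows "(\<Sum>r\<in>{a..b}. u r - u (r - 1)) = u b - u (a - 1)"
proof -
  have "(\<Sum>r\<in>{a..a + int k - 1}. u r - u (r - 1)) = u (a + int k - 1) - u (a - 1)" for k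
  proof (induction k)
    case (Suc k)
    have "{a..a + int (Suc k) - 1} = insert (a + int k) {a..a + int k - 1}" by auto
    with Suc show ?case by (simp add: algebra_simps)
  qed simp
  from this[of "nat (b + 1 - a)"] assms show ?thesis by simp
qed

lemma bailey_sum_signed_square_rec:
  fixes q :: "'a::field"
  assumes q: "\<forall>k::nat\<ge>1. q ^ k \<noteq> 1"
  defines "\<alpha> \<equiv> \<lambda>r::int. (-1) powi r * q powi (r^2)"
  shows "(1 - q ^ (2 * Suc n)) * bailey_sum q \<alpha> (Suc n) = bailey_sum q \<alpha> n"
proof -
  define N where "N = int (Suc n)"
  let ?P = "inv_qpoch q"
  let ?t = "\<lambda>r. \<alpha> r * ?P (N - r) * ?P (N + r)"
  \<comment> \<open>Telescoping certificate: \<open>u r - u (r - 1)\<close> is the difference of the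
    summands of the two sides.\<close>
  define u where "u r = (-1) powi r * q powi (r^2 + r + N) * ?P (N - r - 1) * ?P (N + r)" for r
  have N0: "N \<ge> 0" by (simp add: N_def)
  have "bailey_sum q \<alpha> n = (\<Sum>r\<in>{-N..N}. \<alpha> r * ?P (N - r - 1) * ?P (N + r - 1))"
    unfolding bailey_sum_def
    by (rule sum.mono_neutral_cong_left) (auto simp: N_def algebra_simps not_le)
  moreover have "(1 - q ^ (2 * Suc n)) * ?t r - \<alpha> r * ?P (N - r - 1) * ?P (N + r - 1) = u r - u (r - 1)"
    if r: "r \<in> {-N..N}" for r
  proof -
    have sq: "r^2 \<ge> 0" by simp
    have nn: "N - r \<ge> 0" "N + r \<ge> 0" using r by auto
    \<comment> \<open>In terms of \<open>A\<close> and \<open>B\<close> the certificate reduces to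
      \<open>1 - A * B - (1 - A) * (1 - B) = B * (1 - A) + A * (1 - B)\<close>.\<close>
    define A where "A = q powi (N - r)"
    define B where "B = q powi (N + r)"
    have "N - r + (N + r) = int (2 * Suc n)" by (simp add: N_def)
    then have AB: "q ^ (2 * Suc n) = A * B"
      using powi_add_nonneg[OF nn, of q] by (simp only: A_def B_def power_int_of_nat)
    have e1: "q powi (r^2 + r + N) = q powi (r^2) * B"
      using powi_add_nonneg[OF sq nn(2), of q] by (simp only: B_def add_ac)
    have "(r - 1)^2 + (r - 1) + N = r^2 + (N - r)"
      by (simp add: power2_eq_square algebra_simps)
    then have e2: "q powi ((r - 1)^2 + (r - 1) + N) = q powi (r^2) * A"
      using powi_add_nonneg[OF sq nn(1), of q] by (simp only: A_def)
    have s: "(-1) powi (r - 1) = - ((-1::'a) powi r)"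
      by (simp add: power_int_diff)
    have p1: "?P (N - r - 1) = ?P (N - r) * (1 - A)" "?P (N + r - 1) = ?P (N + r) * (1 - B)"
      unfolding A_def B_def by (rule inv_qpoch_diff_one[OF q])+
    have "N - (r - 1) - 1 = N - r" "N + (r - 1) = N + r - 1" by auto
    then have u1: "u (r - 1) = - ((-1) powi r) * (q powi (r^2) * A) * ?P (N - r) * (?P (N + r) * (1 - B))"
      unfolding u_def e2 s by (simp only: p1)
    have u0: "u r = (-1) powi r * (q powi (r^2) * B) * (?P (N - r) * (1 - A)) * ?P (N + r)"
      unfolding u_def e1 p1 ..
    show ?thesis
      unfolding AB p1 u0 u1 \<alpha>_def by (simp add: algebra_simps)
  qed
  then have "(\<Sum>r\<in>{-N..N}. (1 - q ^ (2 * Suc n)) * ?t r - \<alpha> r * ?P (N - r - 1) * ?P (N + r - 1))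
      = (\<Sum>r\<in>{-N..N}. u r - u (r - 1))"
    by (rule sum.cong[OF refl])
  \<comment> \<open>Both boundary values \<open>u N\<close> and \<open>u (- N - 1)\<close> contain
    the reciprocal at index -1.\<close>
  moreover have "\<dots> = 0"
    using N0 by (subst sum_int_telescope) (auto simp: u_def)
  ultimately show ?thesis
    by (simp only: sum_subtractf sum_distrib_left[symmetric] bailey_sum_def[of q \<alpha> "Suc n"]
        N_def[symmetric] right_minus_eq diff_self)
qed

text \<open>Both sides satisfy the same recurrence: of the two factors by which \<open>(q;q)\<close>
  grows, the odd one cancels against the new factor of \<open>(q;q^2)\<close>, leaving
  \<open>1 - q ^ (2 * Suc n)\<close>.\<close>

lemma bailey_sum_signed_square:
  fixes q :: "'a::field"
  assumes q: "\<forall>k::nat\<ge>1. q ^ k \<noteq> 1"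
  shows "bailey_sum q (\<lambda>r. (-1) powi r * q powi (r^2)) n
       = qpoch q (q^2) n * inv_qpoch q (2 * int n)"
proof (induction n)
  case 0
  show ?case by (simp add: bailey_sum_def qpoch_def)
next
  case (Suc n)
  let ?P = "\<lambda>k. inv_qpoch q (int k)"
  have "?P (2 * n) = ?P (Suc (Suc (2 * n))) * (1 - q ^ Suc (Suc (2 * n))) * (1 - q ^ Suc (2 * n))"
    by (simp only: inv_qpoch_Suc[OF q, of "2 * n"] inv_qpoch_Suc[OF q, of "Suc (2 * n)"])
  then have "(1 - q ^ (2 * Suc n)) * (qpoch q (q^2) (Suc n) * ?P (2 * Suc n))
      = qpoch q (q^2) n * ?P (2 * n)"
    by (simp add: qpoch_Suc power_mult[symmetric] mult_ac)
  also have "\<dots> = (1 - q ^ (2 * Suc n)) * bailey_sum q (\<lambda>r. (-1) powi r * q powi (r^2)) (Suc n)"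
    using Suc bailey_sum_signed_square_rec[OF q, of n] by simp
  finally show ?case
    using q[rule_format, of "2 * Suc n"] by simp
qed

section \<open>The multiple sum as an iterated Bailey step\<close>

definition tuples_upto :: "nat \<Rightarrow> nat \<Rightarrow> (nat \<Rightarrow> int) set" where
  "tuples_upto p n = {m \<in> mtuples p. m p \<le> int n}"

text \<open>Collects the factors of the summand that do not depend on \<open>n\<close>.\<close>

definition tuple_weight :: "'a::field \<Rightarrow> nat \<Rightarrow> (nat \<Rightarrow> int) \<Rightarrow> 'a" where
  "tuple_weight q p m = q powi (\<Sum>i=1..p. (m i)\<^sup>2) * qpoch q (q\<^sup>2) (nat (m 1))
     * (\<Prod>i=1..<p. inv_qpoch q (m (Suc i) - m i)) * inv_qpoch q (2 * m 1)"

definition tuple_sum :: "'a::field \<Rightarrow> nat \<Rightarrow> nat \<Rightarrow> 'a" where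
  "tuple_sum q p n = (\<Sum>m\<in>tuples_upto p n. tuple_weight q p m * inv_qpoch q (int n - m p))"

lemma finite_tuples_upto: "finite (tuples_upto p n)"
proof (rule finite_subset)
  show "tuples_upto p n \<subseteq> {1..p} \<rightarrow>\<^sub>E {0..int n}"
  proof
    fix m assume "m \<in> tuples_upto p n"
    then have m: "m \<in> mtuples p" "m p \<le> int n" by (auto simp: tuples_upto_def)
    have "m i \<le> int n" if "i \<in> {1..p}" for i
      using mtuples_le_last[OF m(1) that] m(2) by simp
    with m(1) show "m \<in> {1..p} \<rightarrow>\<^sub>E {0..int n}"
      by (auto simp: mtuples_def PiE_iff)
  qed
  show "finite ({1..p} \<rightarrow>\<^sub>E {0..int n})" by (intro finite_PiE) auto
qed

lemma tuple_sum_1: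
  "tuple_sum q 1 n = (\<Sum>k\<le>n. q ^ (k^2) * inv_qpoch q (int n - int k)
      * (qpoch q (q^2) k * inv_qpoch q (2 * int k)))"
  unfolding tuple_sum_def
  by (rule sum.reindex_bij_witness[of _ "\<lambda>k. (\<lambda>i\<in>{1..1}. int k)" "\<lambda>m. nat (m 1)"])
    (auto simp: tuples_upto_def mtuples_def tuple_weight_def PiE_iff extensional_def
      power_int_def nat_power_eq restrict_def fun_eq_iff nat_le_iff)

text \<open>Split off the largest entry \<open>k\<close>. The bound \<open>m p \<le> k\<close> is
  the last monotonicity condition, and the inner factor at \<open>k - m p\<close> becomes the last
  factor of the longer product.\<close>

lemma tuple_sum_Suc:
  assumes p: "p \<ge> 1"
  shows "tuple_sum q (Suc p) n
       = (\<Sum>k\<le>n. q ^ (k^2) * inv_qpoch q (int n - int k) * tuple_sum q p k)"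
proof -
  have "(\<Sum>k\<le>n. q ^ (k^2) * inv_qpoch q (int n - int k) * tuple_sum q p k)
     = (\<Sum>(k, m)\<in>Sigma {..n} (tuples_upto p). q ^ (k^2) * inv_qpoch q (int n - int k)
          * (tuple_weight q p m * inv_qpoch q (int k - m p)))"
    unfolding tuple_sum_def sum_distrib_left
    by (rule sum.Sigma) (simp_all add: finite_tuples_upto)
  also have "\<dots> = tuple_sum q (Suc p) n"
    unfolding tuple_sum_def
  \<comment> \<open>Removing the top entry must reset it to \<open>undefined\<close>, as tuples are
    extensional; hence \<open>restrict\<close>.\<close>
  proof (rule sum.reindex_bij_witness[of _ "\<lambda>m. (nat (m (Suc p)), restrict m {1..p})"
        "\<lambda>(k, m). m(Suc p := int k)"], goal_cases)
    case (1 x)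
    then show ?case
      by (auto simp: tuples_upto_def mtuples_def PiE_iff extensional_def fun_eq_iff)
  next
    case (2 x)
    then show ?case using p
      by (auto simp: tuples_upto_def mtuples_def PiE_iff extensional_def)
  next
    case (3 m)
    then show ?case
      by (auto simp: tuples_upto_def mtuples_def PiE_iff extensional_def fun_eq_iff)
  next
    case (4 m)
    then show ?case using p
      by (auto simp: tuples_upto_def mtuples_def PiE_iff extensional_def nat_le_iff)
  next
    case (5 x)
    obtain k m where x: "x = (k, m)" by force
    let ?m = "m(Suc p := int k)"
    have s: "(\<Sum>i=1..Suc p. (?m i)\<^sup>2) = (\<Sum>i=1..p. (m i)\<^sup>2) + (int k)^2"
      by simp
    have "q powi ((int k)^2) = q ^ (k^2)"
      by (simp add: power_int_def nat_power_eq)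
    then have e: "q powi (\<Sum>i=1..Suc p. (?m i)\<^sup>2) = q powi (\<Sum>i=1..p. (m i)\<^sup>2) * q ^ (k^2)"
      unfolding s by (subst powi_add_nonneg) (auto intro: sum_nonneg)
    have "(\<Prod>i=1..<Suc p. inv_qpoch q (?m (Suc i) - ?m i))
        = (\<Prod>i=1..<p. inv_qpoch q (m (Suc i) - m i)) * inv_qpoch q (int k - m p)"
      using p by (simp add: prod.atLeastLessThan_Suc)
    then show ?case
      unfolding x tuple_weight_def prod.case e using p by (simp del: sum.cl_ivl_Suc add: mult_ac)
  qed
  finally show ?thesis by simp
qed

text \<open>The starting pair has exponent \<open>r^2\<close>, and each Bailey step adds another
  \<open>r^2\<close>; the case \<open>p = 1\<close> is already one step, whence
  \<open>p + 1\<close>.\<close>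

lemma tuple_sum_eq_bailey_sum:
  fixes q :: "'a::field"
  assumes q: "\<forall>k::nat\<ge>1. q ^ k \<noteq> 1" and "p \<ge> 1"
  shows "tuple_sum q p n = bailey_sum q (\<lambda>r. (-1) powi r * q powi ((int p + 1) * r\<^sup>2)) n"
  using assms(2)
proof (induction p arbitrary: n rule: dec_induct)
  case base
  have "q powi ((int 1 + 1) * r\<^sup>2) = q powi (r\<^sup>2) * q powi (r\<^sup>2)" for r
    by (simp add: powi_add_nonneg[symmetric])
  then show ?case
    unfolding tuple_sum_1 bailey_sum_signed_square[OF q, symmetric] bailey_sum_step[OF q]
    by (simp only: mult.assoc)
next
  case (step p)
  have "(int (Suc p) + 1) * r\<^sup>2 = (int p + 1) * r\<^sup>2 + r\<^sup>2" for r
    by (simp add: algebra_simps)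
  then have "q powi ((int (Suc p) + 1) * r\<^sup>2) = q powi ((int p + 1) * r\<^sup>2) * q powi (r\<^sup>2)" for r
    by (simp add: powi_add_nonneg)
  then show ?case
    unfolding tuple_sum_Suc[OF step(1)] step.IH bailey_sum_step[OF q]
    by (simp only: mult.assoc)
qed

theorem theorem8p10:
  fixes q :: "'a::field" and n p :: nat
  assumes "\<And>k::nat. k \<ge> 1 \<Longrightarrow> q ^ k \<noteq> 1"
    and "p \<ge> 1"
  shows "Sum_any (\<lambda>m. if m \<in> mtuples p then
            q powi (\<Sum>i=1..p. (m i)\<^sup>2) * qpoch q (q\<^sup>2) (nat (m 1)) * qpoch q q (2 * n)
            * inv_qpoch q (int n - m p)
            * (\<Prod>i=1..<p. inv_qpoch q (m (Suc i) - m i))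
            * inv_qpoch q (2 * m 1)
          else 0)
       = Sum_any (\<lambda>r::int. (-1) powi r * q powi ((int p + 1) * r\<^sup>2)
            * qbinom q (2 * int n) (int n - r))"
    (is "Sum_any ?L = Sum_any ?R")
proof -
  have q: "\<forall>k::nat\<ge>1. q ^ k \<noteq> 1" using assms(1) by blast
  \<comment> \<open>Tuples with \<open>m p > n\<close> contribute 0 through the reciprocal at
    \<open>n - m p\<close>.\<close>
  have "Sum_any ?L = (\<Sum>m\<in>tuples_upto p n. ?L m)"
    by (rule Sum_any.expand_superset[OF finite_tuples_upto])
      (auto simp: tuples_upto_def not_le intro: ccontr)
  also have "\<dots> = qpoch q q (2 * n) * tuple_sum q p n"
    unfolding tuple_sum_def sum_distrib_left
    by (rule sum.cong) (auto simp: tuples_upto_def tuple_weight_def)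
  also have "\<dots> = qpoch q q (2 * n)
      * bailey_sum q (\<lambda>r. (-1) powi r * q powi ((int p + 1) * r\<^sup>2)) n"
    by (simp only: tuple_sum_eq_bailey_sum[OF q assms(2)])
  \<comment> \<open>Here \<open>2n - (n - r) = n + r\<close> matches the two reciprocals with the
    q-binomial coefficient.\<close>
  also have "\<dots> = (\<Sum>r\<in>{- int n..int n}. ?R r)"
    unfolding bailey_sum_def sum_distrib_left
  proof (rule sum.cong[OF refl])
    fix r assume "r \<in> {- int n..int n}"
    then show "qpoch q q (2 * n) * ((-1) powi r * q powi ((int p + 1) * r\<^sup>2)
        * inv_qpoch q (int n - r) * inv_qpoch q (int n + r)) = ?R r"
      by (simp add: qbinom_def inv_qpoch_def nat_mult_distrib)
  qed
  also have "\<dots> = Sum_any ?R"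
    by (rule Sum_any.expand_superset[symmetric]) (auto simp: qbinom_def split: if_splits)
  finally show ?thesis .
qed

end
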